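(* Let $N$ be a nonnegative integer-valued random variable and let $X_1,X_2,\ldots$ be a sequence of independent and identically distributed nonnegative random variables with mean $\mu=\mathrm{E}[X_1]>0$, all defined on the same probability space. The dependence between $N$ and $\{X_i\}_{i\ge 1}$ is arbitrary. Let $S_0=0$, $S_n=X_1+\cdots+X_n$ for $n\ge 1$, and $S_N=\sum_{i=1}^N X_i$. Suppose that $\mathrm{E}[e^{\gamma X_1}]<\infty$ for some $\gamma>0$ and that there is a positive function $a$, defined in a neighbourhood of infinity, such that $$\lim_{x\to\infty}\frac{\Pr[N>x+y\,a(x)]}{\Pr[N>x]}=e^{-y}\qquad\text{for every } y\in\mathbb R,$$ and $$\frac{a(x)}{x^{2/3}}\to\infty,\qquad x\to\infty.$$ Then $$\Pr[S_N>x]\sim \Pr[N>x/\mu],\qquad x\to\infty.$$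
   Context: The first displayed condition on $N$ (membership of the Gumbel max-domain of attraction with auxiliary function $a$) includes that $\Pr[N>x]>0$ for all $x$. For positive functions $f,g$ defined in a neighbourhood of infinity, $f(x)\sim g(x)$ as $x\to\infty$ means $f(x)/g(x)\to 1$. *)

theory Defs
  imports "HOL-Probability.Probability" "HOL-Library.Landau_Symbols"
begin

definition tail_prob :: "'a measure \<Rightarrow> ('a \<Rightarrow> real) \<Rightarrow> real \<Rightarrow> real" where
  "tail_prob M Y x = measure M {\<omega> \<in> space M. Y \<omega> > x}"

text \<open>
  The auxiliary function \<open>a\<close> only has to be defined (and positive) near infinity. It is represented
  by a total function of which nothing is required outside such a neighbourhood.
\<close>
definition gumbel_mda :: "'a measure \<Rightarrow> ('a \<Rightarrow> real) \<Rightarrow> (real \<Rightarrow> real) \<Rightarrow> bool" where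
  "gumbel_mda M Y a \<longleftrightarrow>
     (\<forall>x. tail_prob M Y x > 0) \<and>
     eventually (\<lambda>x. a x > 0) at_top \<and>
     (\<forall>y. ((\<lambda>x. tail_prob M Y (x + y * a x) / tail_prob M Y x) \<longlongrightarrow> exp (- y)) at_top)"

text \<open>The terms are indexed from 1, so \<open>X 0\<close> never enters.\<close>
definition random_sum :: "('a \<Rightarrow> nat) \<Rightarrow> (nat \<Rightarrow> 'a \<Rightarrow> real) \<Rightarrow> 'a \<Rightarrow> real" where
  "random_sum N X \<omega> = (\<Sum>i = 1..N \<omega>. X i \<omega>)"

end

theory Submission imports Defs "HOL-Real_Asymp.Real_Asymp" begin

text \<open>
  Write \<open>T z\<close> for the probability that \<open>N > z\<close>, and let \<open>w = L * z powr (2/3)\<close>. Since \<open>w\<close> is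
  negligible against \<open>a z\<close>, the Gumbel condition gives \<open>T (z + w) / T z \<rightarrow> 1\<close> and
  \<open>T (z - w) / T z \<rightarrow> 1\<close>; iterating such steps bounds \<open>T z\<close> below by a multiple of
  \<open>exp (- 8 * z powr (1/3))\<close>. If \<open>S_N > \<mu> z\<close> then either \<open>N > z - w\<close> or, by monotonicity of the
  partial sums, a sum of a deterministic number \<open>n \<le> z - w\<close> of terms exceeds its mean by \<open>\<mu> w\<close>;
  symmetrically from below. A Chernoff bound makes the deviation at most
  \<open>exp (- const * w\<^sup>2 / z)\<close>, which for suitable \<open>L\<close> equals \<open>exp (- 9 * z powr (1/3))\<close> and is
  therefore negligible against \<open>T z\<close>, whatever the dependence between \<open>N\<close> and the terms.
\<close>

section \<open>Exponential bounds for sums of independent variables\<close>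

text \<open>Taylor's formula of order two with Lagrange remainder; the intermediate point has
  absolute value at most \<open>\<bar>t\<bar>\<close>.\<close>

lemma exp_le_quadratic:
  fixes t :: real
  shows "exp t \<le> 1 + t + t\<^sup>2 / 2 * exp \<bar>t\<bar>"
proof -
  obtain s where s: "\<bar>s\<bar> \<le> \<bar>t\<bar>" "exp t = (\<Sum>m<2. t ^ m / fact m) + exp s / fact 2 * t ^ 2"
    using Maclaurin_exp_le[of t 2] by blast
  have "exp t = 1 + t + t\<^sup>2 / 2 * exp s"
    using s(2) by (simp add: eval_nat_numeral)
  also have "\<dots> \<le> 1 + t + t\<^sup>2 / 2 * exp \<bar>t\<bar>"
    using s(1) by (intro add_left_mono mult_left_mono) auto
  finally show ?thesis .
qed

text \<open>Mean zero kills the linear term of the second-order expansion, and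
  \<open>1 + v \<le> exp v\<close> turns what is left into a Gaussian bound. Restricting
  \<open>\<theta>\<close> to half the available range leaves the other half of the exponential
  moment to dominate the quadratic factor.\<close>

lemma (in prob_space) centered_mgf_le:
  fixes Y :: "'a \<Rightarrow> real"
  assumes [measurable]: "random_variable borel Y"
    and "\<gamma> > 0" and int: "integrable M (\<lambda>\<omega>. exp (\<gamma> * \<bar>Y \<omega>\<bar>))"
    and "expectation Y = 0"
  obtains K where "K > 0"
    "\<And>\<theta>. \<bar>\<theta>\<bar> \<le> \<gamma> / 2 \<Longrightarrow> integrable M (\<lambda>\<omega>. exp (\<theta> * Y \<omega>))"
    "\<And>\<theta>. \<bar>\<theta>\<bar> \<le> \<gamma> / 2 \<Longrightarrow> expectation (\<lambda>\<omega>. exp (\<theta> * Y \<omega>)) \<le> exp (K * \<theta>\<^sup>2)"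
proof -
  define E where "E = expectation (\<lambda>\<omega>. exp (\<gamma> * \<bar>Y \<omega>\<bar>))"
  have "1 \<le> E"
    unfolding E_def using \<open>\<gamma> > 0\<close> by (intro integral_ge_const int) auto
  have int_Y: "integrable M Y"
  proof (rule Bochner_Integration.integrable_bound[OF integrable_mult_right[OF int, of "1 / \<gamma>"]])
    show "AE \<omega> in M. norm (Y \<omega>) \<le> norm (1 / \<gamma> * exp (\<gamma> * \<bar>Y \<omega>\<bar>))"
    proof (rule AE_I2)
      fix \<omega>
      have "\<gamma> * \<bar>Y \<omega>\<bar> \<le> exp (\<gamma> * \<bar>Y \<omega>\<bar>)"
        using exp_ge_add_one_self[of "\<gamma> * \<bar>Y \<omega>\<bar>"] by linarith
      then show "norm (Y \<omega>) \<le> norm (1 / \<gamma> * exp (\<gamma> * \<bar>Y \<omega>\<bar>))"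
        using \<open>\<gamma> > 0\<close> by (simp add: field_simps)
    qed
  qed measurable
  have int_exp: "integrable M (\<lambda>\<omega>. exp (\<theta> * Y \<omega>))" if "\<bar>\<theta>\<bar> \<le> \<gamma> / 2" for \<theta>
  proof (rule Bochner_Integration.integrable_bound[OF int])
    have "\<theta> * Y \<omega> \<le> \<gamma> * \<bar>Y \<omega>\<bar>" for \<omega>
    proof -
      have "\<theta> * Y \<omega> \<le> \<bar>\<theta>\<bar> * \<bar>Y \<omega>\<bar>"
        by (metis abs_ge_self abs_mult)
      also have "\<dots> \<le> \<gamma> * \<bar>Y \<omega>\<bar>"
        using that \<open>\<gamma> > 0\<close> by (intro mult_right_mono) auto
      finally show ?thesis .
    qed
    then show "AE \<omega> in M. norm (exp (\<theta> * Y \<omega>)) \<le> norm (exp (\<gamma> * \<bar>Y \<omega>\<bar>))"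
      by simp
  qed measurable
  define K where "K = 4 / \<gamma>\<^sup>2 * E"
  have "K > 0"
    using \<open>1 \<le> E\<close> \<open>\<gamma> > 0\<close> by (simp add: K_def)
  have pointwise: "exp (\<theta> * Y \<omega>) \<le> 1 + \<theta> * Y \<omega> + \<theta>\<^sup>2 * (4 / \<gamma>\<^sup>2) * exp (\<gamma> * \<bar>Y \<omega>\<bar>)"
    if "\<bar>\<theta>\<bar> \<le> \<gamma> / 2" for \<theta> \<omega>
  proof -
    \<comment> \<open>The exponent \<open>\<gamma> * \<bar>Y \<omega>\<bar>\<close> is split into
      two halves \<open>y\<close>: one factor \<open>exp y\<close> absorbs the square of
      \<open>y\<close>, the other bounds \<open>exp \<bar>\<theta> * Y \<omega>\<bar>\<close>.
      Expressing \<open>Y \<omega>\<close> through \<open>y\<close> produces the 4 in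
      \<open>K\<close>.\<close>
    define y where "y = \<gamma> / 2 * \<bar>Y \<omega>\<bar>"
    have "0 \<le> y"
      using \<open>\<gamma> > 0\<close> by (simp add: y_def)
    then have y: "y\<^sup>2 / 2 \<le> exp y"
      using exp_lower_Taylor_quadratic[of y] by linarith
    have abs_le: "\<bar>\<theta> * Y \<omega>\<bar> \<le> y"
      unfolding y_def abs_mult using that by (intro mult_right_mono) auto
    have "(\<theta> * Y \<omega>)\<^sup>2 / 2 * exp \<bar>\<theta> * Y \<omega>\<bar> = \<theta>\<^sup>2 * (4 / \<gamma>\<^sup>2) * (y\<^sup>2 / 2 * exp \<bar>\<theta> * Y \<omega>\<bar>)"
      using \<open>\<gamma> > 0\<close> by (simp add: y_def power_mult_distrib field_simps)
    also have "\<dots> \<le> \<theta>\<^sup>2 * (4 / \<gamma>\<^sup>2) * (exp y * exp y)"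
      using y abs_le by (intro mult_left_mono mult_mono) auto
    also have "exp y * exp y = exp (\<gamma> * \<bar>Y \<omega>\<bar>)"
      by (simp add: y_def flip: exp_add)
    finally show ?thesis
      using exp_le_quadratic[of "\<theta> * Y \<omega>"] by linarith
  qed
  have "expectation (\<lambda>\<omega>. exp (\<theta> * Y \<omega>)) \<le> exp (K * \<theta>\<^sup>2)" if "\<bar>\<theta>\<bar> \<le> \<gamma> / 2" for \<theta>
  proof -
    have "expectation (\<lambda>\<omega>. exp (\<theta> * Y \<omega>))
        \<le> expectation (\<lambda>\<omega>. 1 + \<theta> * Y \<omega> + \<theta>\<^sup>2 * (4 / \<gamma>\<^sup>2) * exp (\<gamma> * \<bar>Y \<omega>\<bar>))"
      using pointwise[OF that] int int_Y int_exp[OF that] by (intro integral_mono) auto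
    also have "\<dots> = 1 + K * \<theta>\<^sup>2"
      using int int_Y \<open>expectation Y = 0\<close> prob_space by (simp add: K_def E_def)
    also have "\<dots> \<le> exp (K * \<theta>\<^sup>2)"
      using exp_ge_add_one_self[of "K * \<theta>\<^sup>2"] by simp
    finally show ?thesis .
  qed
  with \<open>K > 0\<close> int_exp show ?thesis
    using that by blast
qed

text \<open>Exponential Markov inequality with a parameter proportional to \<open>s / b\<close>. The
  range \<open>s \<le> r * b\<close> keeps this parameter where the Gaussian bound is available, so
  that a single \<open>c\<close> serves all \<open>J\<close>, \<open>b\<close> and \<open>s\<close>.
  The sign \<open>\<sigma>\<close> covers both tails, and \<open>b\<close> need only dominate the
  number of terms.\<close>

lemma (in prob_space) chernoff_sum:
  fixes Y :: "'i \<Rightarrow> 'a \<Rightarrow> real"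
  assumes indep: "indep_vars (\<lambda>_. borel) Y I"
    and pos: "K > 0" "\<delta> > 0" "r > 0"
    and int: "\<And>i \<theta>. i \<in> I \<Longrightarrow> \<bar>\<theta>\<bar> \<le> \<delta> \<Longrightarrow> integrable M (\<lambda>\<omega>. exp (\<theta> * Y i \<omega>))"
    and mgf: "\<And>i \<theta>. i \<in> I \<Longrightarrow> \<bar>\<theta>\<bar> \<le> \<delta> \<Longrightarrow> expectation (\<lambda>\<omega>. exp (\<theta> * Y i \<omega>)) \<le> exp (K * \<theta>\<^sup>2)"
  obtains c where "c > 0"
    "\<And>J b s \<sigma>. \<lbrakk>J \<subseteq> I; finite J; real (card J) \<le> b; b > 0; 0 \<le> s; s \<le> r * b; \<bar>\<sigma>\<bar> = 1\<rbrakk>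
       \<Longrightarrow> prob {\<omega> \<in> space M. s \<le> \<sigma> * (\<Sum>i\<in>J. Y i \<omega>)} \<le> exp (- c * s\<^sup>2 / b)"
proof -
  \<comment> \<open>The parameter will be \<open>t = \<eta> * s / b\<close>. The first entry makes
    the cost \<open>b * K * t\<^sup>2\<close> at most half of the gain \<open>t * s\<close>; the
    second ensures \<open>t \<le> \<delta>\<close>. The remaining half of the gain gives
    \<open>c = \<eta> / 2\<close>.\<close>
  define \<eta> where "\<eta> = min (1 / (2 * K)) (\<delta> / r)"
  have "\<eta> > 0" and \<eta>: "\<eta> * K \<le> 1 / 2" "\<eta> * r \<le> \<delta>"
    using pos by (auto simp: \<eta>_def min_def field_simps split: if_splits)
  have "prob {\<omega> \<in> space M. s \<le> \<sigma> * (\<Sum>i\<in>J. Y i \<omega>)} \<le> exp (- (\<eta> / 2) * s\<^sup>2 / b)"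
    if J: "J \<subseteq> I" "finite J" "real (card J) \<le> b" and b: "b > 0" and s: "0 \<le> s" "s \<le> r * b"
      and \<sigma>: "\<bar>\<sigma>\<bar> = 1" for J b s \<sigma>
  proof (cases "s = 0")
    case True
    then show ?thesis by simp
  next
    case False
    define t where "t = \<eta> * s / b"
    \<comment> \<open>Moving the sign into the parameter treats the upper and the lower tail at
      once.\<close>
    define \<theta> where "\<theta> = \<sigma> * t"
    have "t > 0"
      using False s b \<open>\<eta> > 0\<close> by (simp add: t_def)
    have "t \<le> \<eta> * r"
      using s b \<open>\<eta> > 0\<close> by (simp add: t_def field_simps)
    then have \<theta>: "\<bar>\<theta>\<bar> \<le> \<delta>" "\<theta>\<^sup>2 = t\<^sup>2"
      using \<sigma> \<eta> \<open>t > 0\<close> by (auto simp: \<theta>_def abs_mult power_mult_distrib simp flip: power2_abs[of \<sigma>])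
    have rv: "random_variable borel (Y i)" if "i \<in> I" for i
      using indep that by (auto simp: indep_vars_def)
    have ind: "indep_vars (\<lambda>_. borel) (\<lambda>i \<omega>. exp (\<theta> * Y i \<omega>)) J"
      using indep_vars_compose2[OF indep_vars_subset[OF indep J(1)], of "\<lambda>_ x. exp (\<theta> * x)" "\<lambda>_. borel"]
      by simp
    have intJ: "integrable M (\<lambda>\<omega>. exp (\<theta> * Y i \<omega>))" if "i \<in> J" for i
      using int that J \<theta> by auto
    have exp_prod: "exp (t * (\<sigma> * (\<Sum>i\<in>J. Y i \<omega>))) = (\<Prod>i\<in>J. exp (\<theta> * Y i \<omega>))" for \<omega>
      using J(2) by (simp add: \<theta>_def sum_distrib_left mult_ac flip: exp_sum)
    have [measurable]: "(\<lambda>\<omega>. \<Sum>i\<in>J. Y i \<omega>) \<in> borel_measurable M"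
      using rv J by (intro borel_measurable_sum) auto
    have "prob {\<omega> \<in> space M. s \<le> \<sigma> * (\<Sum>i\<in>J. Y i \<omega>)}
        = prob {\<omega> \<in> space M. exp (t * s) \<le> exp (t * (\<sigma> * (\<Sum>i\<in>J. Y i \<omega>)))}"
      using \<open>t > 0\<close> by simp
    also have "\<dots> \<le> expectation (\<lambda>\<omega>. exp (t * (\<sigma> * (\<Sum>i\<in>J. Y i \<omega>)))) / exp (t * s)"
    proof (rule integral_Markov_inequality_measure[where A = "{}"])
      show "integrable M (\<lambda>\<omega>. exp (t * (\<sigma> * (\<Sum>i\<in>J. Y i \<omega>))))"
        unfolding exp_prod by (rule indep_vars_integrable[OF J(2) ind intJ])
    qed auto
    also have "expectation (\<lambda>\<omega>. exp (t * (\<sigma> * (\<Sum>i\<in>J. Y i \<omega>))))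
        = (\<Prod>i\<in>J. expectation (\<lambda>\<omega>. exp (\<theta> * Y i \<omega>)))"
      unfolding exp_prod by (rule indep_vars_lebesgue_integral[OF J(2) ind intJ])
    also have "\<dots> \<le> (\<Prod>i\<in>J. exp (K * t\<^sup>2))"
      using mgf J \<theta> by (intro prod_mono conjI integral_nonneg_AE) (auto simp flip: \<theta>(2))
    also have "\<dots> = exp (real (card J) * (K * t\<^sup>2))"
      by (simp add: exp_of_nat_mult)
    also have "\<dots> \<le> exp (b * (K * t\<^sup>2))"
      using J(3) pos by (simp add: mult_right_mono)
    also have "b * (K * t\<^sup>2) = (\<eta> * K) * (\<eta> * s\<^sup>2 / b)"
      using b by (simp add: t_def power2_eq_square field_simps)
    also have "exp \<dots> \<le> exp (1 / 2 * (\<eta> * s\<^sup>2 / b))"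
      unfolding exp_le_cancel_iff using \<eta>(1) \<open>\<eta> > 0\<close> b by (intro mult_right_mono) auto
    also have "\<dots> / exp (t * s) = exp (- (\<eta> / 2) * s\<^sup>2 / b)"
      using b by (simp add: t_def power2_eq_square field_simps flip: exp_diff)
    finally show ?thesis
      by (simp add: divide_right_mono)
  qed
  with \<open>\<eta> > 0\<close> show ?thesis
    by (intro that[of "\<eta> / 2"]) auto
qed

section \<open>Tails in the Gumbel domain with large auxiliary function\<close>

text \<open>For every \<open>\<epsilon> > 0\<close> the shift is eventually at most
  \<open>\<epsilon> * a x\<close> in absolute value. Monotonicity then traps the ratio between
  limits \<open>exp (- \<epsilon>)\<close> and \<open>exp \<epsilon>\<close>, both arbitrarily close
  to 1.\<close>

lemma tail_insensitive:
  fixes T a :: "real \<Rightarrow> real"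
  assumes "antimono T" and pos: "\<And>x. T x > 0"
    and gumbel: "\<And>y. ((\<lambda>x. T (x + y * a x) / T x) \<longlongrightarrow> exp (- y)) at_top"
    and growth: "filterlim (\<lambda>x. a x / x powr (2/3)) at_top at_top"
  shows "((\<lambda>x. T (x + K * x powr (2/3)) / T x) \<longlongrightarrow> 1) at_top"
proof -
  have dom: "\<forall>\<^sub>F x in at_top. \<bar>K\<bar> * x powr (2/3) \<le> \<epsilon> * a x" if "\<epsilon> > 0" for \<epsilon>
  proof -
    have "\<forall>\<^sub>F x in at_top. \<bar>K\<bar> / \<epsilon> \<le> a x / x powr (2/3)"
      using growth by (simp add: filterlim_at_top)
    then show ?thesis
      using eventually_gt_at_top[of 0]
    proof eventually_elim
      case (elim x)
      have "x powr (2/3) > 0"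
        using elim by simp
      then show ?case
        using elim that by (simp add: field_simps)
    qed
  qed
  show ?thesis
  proof (rule order_tendstoI)
    fix l :: real assume "l < 1"
    \<comment> \<open>For positive \<open>l\<close> this makes \<open>exp (- \<epsilon>)\<close> the
      square root of \<open>l\<close>, which exceeds \<open>l\<close>; for \<open>l \<le> 0\<close>
      any positive value would do.\<close>
    define \<epsilon> where "\<epsilon> = (if l \<le> 0 then 1 else - ln l / 2)"
    have "\<epsilon> > 0"
      using \<open>l < 1\<close> by (simp add: \<epsilon>_def)
    have "l < exp (- \<epsilon>)"
    proof (cases "l \<le> 0")
      case False
      then have "ln l < - \<epsilon>"
        using \<open>l < 1\<close> ln_less_zero[of l] by (simp add: \<epsilon>_def)
      then show ?thesis
        using False exp_less_mono[of "ln l" "- \<epsilon>"] by simp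
    qed (use exp_gt_zero[of "- \<epsilon>"] in linarith)
    then have "\<forall>\<^sub>F x in at_top. l < T (x + \<epsilon> * a x) / T x"
      by (rule order_tendstoD(1)[OF gumbel])
    then show "\<forall>\<^sub>F x in at_top. l < T (x + K * x powr (2/3)) / T x"
      using dom[OF \<open>\<epsilon> > 0\<close>]
    proof eventually_elim
      case (elim x)
      have "K * x powr (2/3) \<le> \<bar>K\<bar> * x powr (2/3)"
        by (intro mult_right_mono) auto
      then have "T (x + \<epsilon> * a x) \<le> T (x + K * x powr (2/3))"
        using elim by (intro antimonoD[OF \<open>antimono T\<close>]) auto
      then have "T (x + \<epsilon> * a x) / T x \<le> T (x + K * x powr (2/3)) / T x"
        using pos[of x] by (intro divide_right_mono) auto
      then show ?case
        using elim(1) by linarith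
    qed
  next
    fix u :: real assume "u > 1"
    define \<epsilon> where "\<epsilon> = ln u / 2"
    have "\<epsilon> > 0"
      using \<open>u > 1\<close> by (simp add: \<epsilon>_def)
    have "\<epsilon> < ln u"
      using \<open>u > 1\<close> by (simp add: \<epsilon>_def)
    then have "exp (- (- \<epsilon>)) < u"
      using \<open>u > 1\<close> exp_less_mono[of \<epsilon> "ln u"] by simp
    then have "\<forall>\<^sub>F x in at_top. T (x + (- \<epsilon>) * a x) / T x < u"
      by (rule order_tendstoD(2)[OF gumbel])
    then show "\<forall>\<^sub>F x in at_top. T (x + K * x powr (2/3)) / T x < u"
      using dom[OF \<open>\<epsilon> > 0\<close>]
    proof eventually_elim
      case (elim x)
      have "- (\<bar>K\<bar> * x powr (2/3)) \<le> K * x powr (2/3)"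
        using mult_right_mono[of "- \<bar>K\<bar>" K "x powr (2/3)"] by simp
      then have "T (x + K * x powr (2/3)) \<le> T (x + (- \<epsilon>) * a x)"
        using elim by (intro antimonoD[OF \<open>antimono T\<close>]) auto
      then have "T (x + K * x powr (2/3)) / T x \<le> T (x + (- \<epsilon>) * a x) / T x"
        using pos[of x] by (intro divide_right_mono) auto
      then show ?case
        using elim(1) by linarith
    qed
  qed
qed

text \<open>On the cube-root scale a step of length \<open>x powr (2/3)\<close> advances by at least \<open>1/4\<close>, and each
  such step costs at most a constant factor.\<close>
lemma tail_lower_bound:
  fixes T :: "real \<Rightarrow> real"
  assumes "antimono T" and pos: "\<And>x. T x > 0"
    and lim: "((\<lambda>x. T (x + x powr (2/3)) / T x) \<longlongrightarrow> 1) at_top"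
  obtains C where "C > 0" "\<forall>\<^sub>F x in at_top. C * exp (- 8 * x powr (1/3)) \<le> T x"
proof -
  \<comment> \<open>A loss of \<open>exp (- 2)\<close> per step, at four steps per unit on the
    cube-root scale, accounts for the rate 8.\<close>
  have "\<forall>\<^sub>F x in at_top. exp (- 2) < T (x + x powr (2/3)) / T x"
    by (rule order_tendstoD(1)[OF lim]) simp
  then obtain x0 where x0: "\<And>x. x \<ge> x0 \<Longrightarrow> exp (- 2) < T (x + x powr (2/3)) / T x"
    by (auto simp: eventually_at_top_linorder)
  \<comment> \<open>The bound \<open>u \<ge> 1\<close> gives \<open>u \<le> u ^ 3\<close>, so
    \<open>u \<ge> x0\<close> carries over to the cube; it also lets the square of \<open>u\<close>
    absorb the lower-order terms of the expansion below.\<close>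
  define u0 where "u0 = max 1 x0"
  have step: "exp (- 2) * T (u ^ 3) \<le> T ((u + 1/4) ^ 3)" if "u \<ge> u0" for u
  proof -
    have "u \<ge> 1"
      using that by (simp add: u0_def)
    then have "u \<le> u ^ 3"
      using self_le_power[of u 3] by simp
    then have "x0 \<le> u ^ 3"
      using that by (simp add: u0_def)
    moreover have "(u ^ 3) powr (2/3) = u\<^sup>2"
      using \<open>u \<ge> 1\<close> powr_powr[of u 3 "2/3"] by simp
    ultimately have "exp (- 2) * T (u ^ 3) \<le> T (u ^ 3 + u\<^sup>2)"
      using x0[of "u ^ 3"] pos[of "u ^ 3"] by (simp add: field_simps)
    also have "\<dots> \<le> T ((u + 1/4) ^ 3)"
    proof (rule antimonoD[OF \<open>antimono T\<close>])
      have "u \<le> u\<^sup>2" "1 \<le> u\<^sup>2"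
        using \<open>u \<ge> 1\<close> self_le_power[of u 2] one_le_power[of u 2] by auto
      \<comment> \<open>The coefficients after the leading one sum to 61/64, which is less than 1;
        this is why an advance of 1/4 fits into one step.\<close>
      moreover have "(u + 1/4) ^ 3 = u ^ 3 + 3/4 * u\<^sup>2 + 3/16 * u + 1/64"
        by (simp add: power3_eq_cube power2_eq_square field_simps)
      ultimately show "(u + 1/4) ^ 3 \<le> u ^ 3 + u\<^sup>2"
        by linarith
    qed
    finally show ?thesis .
  qed
  have iter: "exp (- 2 * real n) * T (u0 ^ 3) \<le> T ((u0 + real n / 4) ^ 3)" for n
  proof (induction n)
    case (Suc n)
    have "exp (- 2 * real (Suc n)) * T (u0 ^ 3) = exp (- 2) * (exp (- 2 * real n) * T (u0 ^ 3))"
      by (simp add: algebra_simps flip: exp_add)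
    also have "\<dots> \<le> exp (- 2) * T ((u0 + real n / 4) ^ 3)"
      using Suc.IH by (intro mult_left_mono) auto
    also have "\<dots> \<le> T ((u0 + real n / 4 + 1/4) ^ 3)"
      by (rule step) simp
    also have "u0 + real n / 4 + 1/4 = u0 + real (Suc n) / 4"
      by (simp add: field_simps)
    finally show ?case .
  qed simp
  have "exp (- 2) * T (u0 ^ 3) * exp (- 8 * x powr (1/3)) \<le> T x" if "x \<ge> u0 ^ 3" for x
  proof -
    define u where "u = x powr (1/3)"
    \<comment> \<open>The number of quarter steps that lead from \<open>u0\<close> to
      \<open>u\<close> or just beyond. Rounding up costs at most one more factor
      \<open>exp (- 2)\<close>, which goes into the constant.\<close>
    define n where "n = nat \<lceil>4 * (u - u0)\<rceil>"
    have "u0 \<ge> 1"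
      by (simp add: u0_def)
    then have "x > 0"
      using that zero_less_power[of u0 3] by linarith
    then have u3: "u ^ 3 = x" and "u \<ge> 0"
      by (simp_all add: u_def powr_power)
    have "u0 \<le> u"
      using that \<open>u \<ge> 0\<close> \<open>u0 \<ge> 1\<close> by (simp flip: u3)
    then have "real n = of_int \<lceil>4 * (u - u0)\<rceil>"
      by (simp add: n_def)
    then have n: "4 * (u - u0) \<le> real n" "real n \<le> 4 * (u - u0) + 1"
      by linarith+
    have "exp (- 2) * T (u0 ^ 3) * exp (- 8 * u) = exp (- 2 - 8 * u) * T (u0 ^ 3)"
      by (simp add: exp_diff exp_minus field_simps)
    also have "\<dots> \<le> exp (- 2 * real n) * T (u0 ^ 3)"
      using n(2) \<open>u0 \<ge> 1\<close> pos[of "u0 ^ 3"] by (intro mult_right_mono) auto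
    also have "\<dots> \<le> T ((u0 + real n / 4) ^ 3)"
      by (rule iter)
    also have "\<dots> \<le> T (u ^ 3)"
      using n(1) \<open>u \<ge> 0\<close> by (intro antimonoD[OF \<open>antimono T\<close>] power_mono) auto
    finally show ?thesis
      by (simp add: u3 flip: u_def)
  qed
  then show ?thesis
    using pos[of "u0 ^ 3"] by (intro that[of "exp (- 2) * T (u0 ^ 3)"] eventually_at_top_linorderI) auto
qed

text \<open>The rate 9 beats the rate 8 of the lower bound, leaving a factor
  \<open>exp (- (x powr (1/3)))\<close>.\<close>

lemma tail_dominates_exp:
  fixes T :: "real \<Rightarrow> real"
  assumes "antimono T" and pos: "\<And>x. T x > 0"
    and lim: "((\<lambda>x. T (x + x powr (2/3)) / T x) \<longlongrightarrow> 1) at_top"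
  shows "((\<lambda>x. exp (- 9 * x powr (1/3)) / T x) \<longlongrightarrow> 0) at_top"
proof -
  obtain C where C: "C > 0" "\<forall>\<^sub>F x in at_top. C * exp (- 8 * x powr (1/3)) \<le> T x"
    using tail_lower_bound[OF assms] by blast
  show ?thesis
  proof (rule tendsto_sandwich[where f = "\<lambda>_. 0" and h = "\<lambda>x. exp (- (x powr (1/3))) / C"])
    show "\<forall>\<^sub>F x in at_top. exp (- 9 * x powr (1/3)) / T x \<le> exp (- (x powr (1/3))) / C"
      using C(2)
    proof eventually_elim
      case (elim x)
      have "exp (- 9 * x powr (1/3)) / T x \<le> exp (- 9 * x powr (1/3)) / (C * exp (- 8 * x powr (1/3)))"
        using elim C(1) pos[of x] by (intro divide_left_mono mult_pos_pos) auto
      also have "\<dots> = exp (- (x powr (1/3))) / C"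
        using C(1) by (simp add: field_simps flip: exp_add)
      finally show ?case .
    qed
    show "((\<lambda>x. exp (- (x powr (1/3))) / C) \<longlongrightarrow> 0) at_top"
      using C(1) by real_asymp
  qed (auto intro!: always_eventually simp: pos less_imp_le)
qed

section \<open>The random sum\<close>

theorem theorem4p1:
  fixes M :: "'a measure" and N :: "'a \<Rightarrow> nat" and X :: "nat \<Rightarrow> 'a \<Rightarrow> real"
    and a :: "real \<Rightarrow> real" and \<mu> \<gamma> :: real
  assumes prob: "prob_space M"
    and N_rv: "N \<in> measurable M (count_space UNIV)"
    and X_indep: "prob_space.indep_vars M (\<lambda>_. borel) X {1..}"
    and X_ident: "\<And>i. i \<ge> 1 \<Longrightarrow> distr M borel (X i) = distr M borel (X 1)"
    and X_nonneg: "\<And>i. i \<ge> 1 \<Longrightarrow> AE \<omega> in M. X i \<omega> \<ge> 0"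
    and mean: "\<mu> = integral\<^sup>L M (X 1)" "\<mu> > 0"
    and exp_moment: "\<gamma> > 0" "integrable M (\<lambda>\<omega>. exp (\<gamma> * X 1 \<omega>))"
    and gumbel: "gumbel_mda M (\<lambda>\<omega>. real (N \<omega>)) a"
    and a_growth: "filterlim (\<lambda>x. a x / x powr (2/3)) at_top at_top"
  shows "(\<lambda>x. tail_prob M (random_sum N X) x) \<sim>[at_top]
           (\<lambda>x. tail_prob M (\<lambda>\<omega>. real (N \<omega>)) (x / \<mu>))"
proof -
  interpret prob_space M by (rule prob)
  note N_rv[measurable]
  have rv[measurable]: "random_variable borel (X i)" if "i \<ge> 1" for i
    using X_indep that by (auto simp: indep_vars_def)

  \<comment> \<open>Partial sums and their monotonicity\<close>
  define S where "S n \<omega> = (\<Sum>i = 1..n. X i \<omega>)" for n \<omega>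
  have S_rv[measurable]: "S n \<in> borel_measurable M" for n
    unfolding S_def by (intro borel_measurable_sum rv) auto
  have SN_rv[measurable]: "(\<lambda>\<omega>. S (N \<omega>) \<omega>) \<in> borel_measurable M"
    by (rule measurable_compose_countable[OF S_rv N_rv])
  \<comment> \<open>Nonnegativity holds only almost surely for each term; the countably many
    exceptional null sets are merged, so that monotonicity may be used at the random index
    \<open>N \<omega>\<close>.\<close>
  have S_mono: "AE \<omega> in M. \<forall>m n. m \<le> n \<longrightarrow> S m \<omega> \<le> S n \<omega>"
  proof -
    have "AE \<omega> in M. \<forall>i. i \<ge> 1 \<longrightarrow> X i \<omega> \<ge> 0"
      using X_nonneg by (auto simp: AE_all_countable)
    then show ?thesis
      by eventually_elim (auto simp: S_def intro!: sum_mono2)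
  qed

  \<comment> \<open>The tail of \<open>N\<close>\<close>
  define T where "T = tail_prob M (\<lambda>\<omega>. real (N \<omega>))"
  have T_eq: "T x = prob {\<omega> \<in> space M. x < real (N \<omega>)}" for x
    by (simp add: T_def tail_prob_def)
  have "antimono T"
    by (rule antimonoI) (auto simp: T_eq intro!: finite_measure_mono)
  have T_pos: "T x > 0" for x
    using gumbel by (simp add: gumbel_mda_def T_def)
  have T_lim: "((\<lambda>x. T (x + K * x powr (2/3)) / T x) \<longlongrightarrow> 1) at_top" for K
    using gumbel by (intro tail_insensitive[OF \<open>antimono T\<close> T_pos _ a_growth])
      (simp add: gumbel_mda_def T_def)
  have T_exp: "((\<lambda>x. exp (- 9 * x powr (1/3)) / T x) \<longlongrightarrow> 0) at_top"
    using T_lim[of 1] by (intro tail_dominates_exp \<open>antimono T\<close> T_pos) simp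

  \<comment> \<open>Centred terms and their deviations\<close>
  define Y where "Y i \<omega> = X i \<omega> - \<mu>" for i \<omega>
  have Y_indep: "indep_vars (\<lambda>_. borel) Y {1..}"
    using indep_vars_compose2[OF X_indep, of "\<lambda>_ x. x - \<mu>" "\<lambda>_. borel"] by (simp add: Y_def[abs_def])
  have Y_rv[measurable]: "random_variable borel (Y 1)"
    unfolding Y_def by measurable
  have "integrable M (\<lambda>\<omega>. exp (\<gamma> * \<bar>Y 1 \<omega>\<bar>))"
  proof (rule Bochner_Integration.integrable_bound[OF integrable_mult_right[OF exp_moment(2), of "exp (\<gamma> * \<mu>)"]])
    show "AE \<omega> in M. norm (exp (\<gamma> * \<bar>Y 1 \<omega>\<bar>)) \<le> norm (exp (\<gamma> * \<mu>) * exp (\<gamma> * X 1 \<omega>))"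
      using X_nonneg[of 1, simplified]
    proof eventually_elim
      case (elim \<omega>)
      have "\<gamma> * \<bar>Y 1 \<omega>\<bar> \<le> \<gamma> * (\<mu> + X 1 \<omega>)"
        using elim mean(2) exp_moment(1) by (intro mult_left_mono) (auto simp: Y_def)
      then show ?case
        by (simp add: algebra_simps flip: exp_add)
    qed
  qed measurable
  \<comment> \<open>The integral of a non-integrable function is 0 by convention, so a positive mean
    forces integrability.\<close>
  moreover have "integrable M (X 1)"
    using mean not_integrable_integral_eq[of M "X 1"] by fastforce
  then have "expectation (Y 1) = 0"
    using prob_space mean(1) by (simp add: Y_def[abs_def])
  ultimately obtain K where K: "K > 0"
    "\<And>\<theta>. \<bar>\<theta>\<bar> \<le> \<gamma> / 2 \<Longrightarrow> integrable M (\<lambda>\<omega>. exp (\<theta> * Y 1 \<omega>))"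
    "\<And>\<theta>. \<bar>\<theta>\<bar> \<le> \<gamma> / 2 \<Longrightarrow> expectation (\<lambda>\<omega>. exp (\<theta> * Y 1 \<omega>)) \<le> exp (K * \<theta>\<^sup>2)"
    using centered_mgf_le[OF Y_rv exp_moment(1)] by metis
  have transfer: "integrable M (\<lambda>\<omega>. exp (\<theta> * Y i \<omega>)) \<longleftrightarrow> integrable M (\<lambda>\<omega>. exp (\<theta> * Y 1 \<omega>))"
    "expectation (\<lambda>\<omega>. exp (\<theta> * Y i \<omega>)) = expectation (\<lambda>\<omega>. exp (\<theta> * Y 1 \<omega>))"
    if "i \<ge> 1" for i \<theta>
    using integrable_distr_eq[OF rv[OF that], of "\<lambda>x. exp (\<theta> * (x - \<mu>))"]
      integrable_distr_eq[OF rv[of 1], of "\<lambda>x. exp (\<theta> * (x - \<mu>))"]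
      integral_distr[OF rv[OF that], of "\<lambda>x. exp (\<theta> * (x - \<mu>))"]
      integral_distr[OF rv[of 1], of "\<lambda>x. exp (\<theta> * (x - \<mu>))"]
      X_ident[OF that] by (simp_all add: Y_def)
  \<comment> \<open>The choice \<open>r = \<mu>\<close> suffices: deviations have size
    \<open>\<mu> * w z\<close> with \<open>w z \<le> z\<close>, and \<open>b\<close> will be
    \<open>3 * z\<close>.\<close>
  obtain c where c: "c > 0"
    "\<And>J b s \<sigma>. \<lbrakk>J \<subseteq> {1::nat..}; finite J; real (card J) \<le> b; b > 0; 0 \<le> s; s \<le> \<mu> * b; \<bar>\<sigma>\<bar> = 1\<rbrakk>
       \<Longrightarrow> prob {\<omega> \<in> space M. s \<le> \<sigma> * (\<Sum>i\<in>J. Y i \<omega>)} \<le> exp (- c * s\<^sup>2 / b)"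
  proof (rule chernoff_sum[OF Y_indep K(1) _ mean(2), of "\<gamma> / 2"])
    show "0 < \<gamma> / 2"
      using exp_moment(1) by simp
    show "integrable M (\<lambda>\<omega>. exp (\<theta> * Y i \<omega>))" if "i \<in> {1..}" "\<bar>\<theta>\<bar> \<le> \<gamma> / 2" for i \<theta>
      using K(2) transfer(1)[of i \<theta>] that by simp
    show "expectation (\<lambda>\<omega>. exp (\<theta> * Y i \<omega>)) \<le> exp (K * \<theta>\<^sup>2)"
      if "i \<in> {1..}" "\<bar>\<theta>\<bar> \<le> \<gamma> / 2" for i \<theta>
      using K(3) transfer(2)[of i \<theta>] that by simp
  qed blast
  have sum_Y: "(\<Sum>i = 1..n. Y i \<omega>) = S n \<omega> - real n * \<mu>" for n \<omega>
    by (simp add: Y_def S_def sum_subtractf)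

  \<comment> \<open>Solves \<open>c * (\<mu> * w z)\<^sup>2 / (3 * z) = 9 * z powr (1/3)\<close>, so
    that the deviation bound has exactly the rate that the tail of \<open>N\<close>
    dominates.\<close>
  define L where "L = sqrt (27 / (c * \<mu>\<^sup>2))"
  have "L > 0"
    using c(1) mean(2) by (simp add: L_def)
  define w where "w z = L * z powr (2/3)" for z
  \<comment> \<open>The bound \<open>3 * z\<close> leaves room for the largest index used later,
    which is below \<open>z + w z + 1\<close>, when \<open>w z \<le> z\<close> and
    \<open>z \<ge> 1\<close>.\<close>
  have deviation: "prob {\<omega> \<in> space M. \<mu> * w z \<le> \<sigma> * (S n \<omega> - real n * \<mu>)} \<le> exp (- 9 * z powr (1/3))"
    if "z > 0" "w z \<le> z" "real n \<le> 3 * z" "\<bar>\<sigma>\<bar> = 1" for z n \<sigma>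
  proof -
    have "prob {\<omega> \<in> space M. \<mu> * w z \<le> \<sigma> * (S n \<omega> - real n * \<mu>)} \<le> exp (- (c * (\<mu> * w z)\<^sup>2) / (3 * z))"
      using c(2)[of "{1..n}" "3 * z" "\<mu> * w z" \<sigma>] that mean(2) \<open>L > 0\<close>
      by (simp add: w_def flip: sum_Y)
    also have "c * (\<mu> * w z)\<^sup>2 = 27 * (z powr (2/3))\<^sup>2"
      using c(1) mean(2) by (simp add: w_def L_def power_mult_distrib)
    also have "(z powr (2/3))\<^sup>2 = z * z powr (1/3)"
      using \<open>z > 0\<close> by (simp add: powr_power powr_mult_base)
    finally show ?thesis
      using \<open>z > 0\<close> by simp
  qed

  \<comment> \<open>Two-sided comparison of the tails of the random sum and of
    \<open>N\<close>\<close>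
  define P where "P z = prob {\<omega> \<in> space M. \<mu> * z < S (N \<omega>) \<omega>}" for z
  have w_le: "\<forall>\<^sub>F z in at_top. w z \<le> z"
    unfolding w_def using \<open>L > 0\<close> by real_asymp
  have upper: "P z \<le> T (z - w z) + exp (- 9 * z powr (1/3))" if z: "z \<ge> 1" "w z \<le> z" for z
  proof -
    \<comment> \<open>For integers, \<open>N \<omega> \<le> z - w z\<close> means
      \<open>N \<omega> \<le> n\<close>. Monotonicity thus replaces the random index by a fixed one,
      and the union bound needs no information on the dependence.\<close>
    define n where "n = nat \<lfloor>z - w z\<rfloor>"
    have "w z \<ge> 0"
      using \<open>L > 0\<close> by (simp add: w_def)
    have "real n = of_int \<lfloor>z - w z\<rfloor>"
      using z by (simp add: n_def)
    then have n: "real n \<le> z - w z" "z - w z < real n + 1"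
      by linarith+
    have sub: "\<mu> * w z \<le> \<mu> * z - real n * \<mu>"
      using n(1) mean(2) mult_left_mono[of "w z" "z - real n" \<mu>] by (simp add: algebra_simps)
    have "P z \<le> prob ({\<omega> \<in> space M. z - w z < real (N \<omega>)} \<union> {\<omega> \<in> space M. \<mu> * w z \<le> 1 * (S n \<omega> - real n * \<mu>)})"
      unfolding P_def
    proof (rule finite_measure_mono_AE)
      show "AE \<omega> in M. \<omega> \<in> {\<omega> \<in> space M. \<mu> * z < S (N \<omega>) \<omega>} \<longrightarrow> \<omega> \<in> {\<omega> \<in> space M. z - w z < real (N \<omega>)}
          \<union> {\<omega> \<in> space M. \<mu> * w z \<le> 1 * (S n \<omega> - real n * \<mu>)}"
        using S_mono
      proof eventually_elim
        case (elim \<omega>)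
        have "S (N \<omega>) \<omega> \<le> S n \<omega>" if "real (N \<omega>) \<le> z - w z"
          using elim that n(2) by (auto simp: n_def le_nat_floor)
        then show ?case
          using sub by force
      qed
    qed measurable
    also have "\<dots> \<le> T (z - w z) + prob {\<omega> \<in> space M. \<mu> * w z \<le> 1 * (S n \<omega> - real n * \<mu>)}"
      unfolding T_eq by (intro measure_Un_le) measurable
    also have "\<dots> \<le> T (z - w z) + exp (- 9 * z powr (1/3))"
      using z n \<open>w z \<ge> 0\<close> by (intro add_left_mono deviation) auto
    finally show ?thesis .
  qed
  have lower: "T (z + w z) - exp (- 9 * z powr (1/3)) \<le> P z" if z: "z \<ge> 1" "w z \<le> z" for z
  proof -
    \<comment> \<open>Dually, \<open>N \<omega> > z + w z\<close> forces
      \<open>N \<omega> \<ge> n\<close>. If the random sum nevertheless stays at or below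
      \<open>\<mu> * z\<close>, so does \<open>S n \<omega>\<close>, which is a lower deviation,
      handled by the sign \<open>- 1\<close>.\<close>
    define n where "n = nat \<lceil>z + w z\<rceil>"
    have "w z \<ge> 0"
      using \<open>L > 0\<close> by (simp add: w_def)
    then have "real n = of_int \<lceil>z + w z\<rceil>"
      using z by (simp add: n_def)
    then have n: "z + w z \<le> real n" "real n < z + w z + 1"
      by linarith+
    have sub: "\<mu> * w z \<le> real n * \<mu> - \<mu> * z"
      using n(1) mean(2) mult_left_mono[of "w z" "real n - z" \<mu>] by (simp add: algebra_simps)
    have "T (z + w z) \<le> prob ({\<omega> \<in> space M. \<mu> * z < S (N \<omega>) \<omega>} \<union> {\<omega> \<in> space M. \<mu> * w z \<le> - 1 * (S n \<omega> - real n * \<mu>)})"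
      unfolding T_eq
    proof (rule finite_measure_mono_AE)
      show "AE \<omega> in M. \<omega> \<in> {\<omega> \<in> space M. z + w z < real (N \<omega>)} \<longrightarrow> \<omega> \<in> {\<omega> \<in> space M. \<mu> * z < S (N \<omega>) \<omega>}
          \<union> {\<omega> \<in> space M. \<mu> * w z \<le> - 1 * (S n \<omega> - real n * \<mu>)}"
        using S_mono
      proof eventually_elim
        case (elim \<omega>)
        have "n \<le> N \<omega>" if "z + w z < real (N \<omega>)"
          using that by (simp add: n_def ceiling_le_iff nat_le_iff)
        then have "S n \<omega> \<le> S (N \<omega>) \<omega>" if "z + w z < real (N \<omega>)"
          using elim that by auto
        then show ?case
          using sub by force
      qed
    qed measurable
    also have "\<dots> \<le> P z + prob {\<omega> \<in> space M. \<mu> * w z \<le> - 1 * (S n \<omega> - real n * \<mu>)}"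
      unfolding P_def by (intro measure_Un_le) measurable
    also have "\<dots> \<le> P z + exp (- 9 * z powr (1/3))"
      using z n by (intro add_left_mono deviation) auto
    finally show ?thesis by simp
  qed

  \<comment> \<open>Passage to the limit and the substitution \<open>z = x / \<mu>\<close>\<close>
  have "((\<lambda>z. P z / T z) \<longlongrightarrow> 1) at_top"
  proof (rule tendsto_sandwich)
    show "\<forall>\<^sub>F z in at_top. T (z + L * z powr (2/3)) / T z - exp (- 9 * z powr (1/3)) / T z \<le> P z / T z"
      using eventually_ge_at_top[of 1] w_le
    proof eventually_elim
      case (elim z)
      show ?case
        using divide_right_mono[OF lower[OF elim], of "T z"] T_pos[of z]
        by (simp add: w_def diff_divide_distrib)
    qed
    show "\<forall>\<^sub>F z in at_top. P z / T z \<le> T (z + (- L) * z powr (2/3)) / T z + exp (- 9 * z powr (1/3)) / T z"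
      using eventually_ge_at_top[of 1] w_le
    proof eventually_elim
      case (elim z)
      show ?case
        using divide_right_mono[OF upper[OF elim], of "T z"] T_pos[of z]
        by (simp add: w_def add_divide_distrib)
    qed
    show "((\<lambda>z. T (z + L * z powr (2/3)) / T z - exp (- 9 * z powr (1/3)) / T z) \<longlongrightarrow> 1) at_top"
      using tendsto_diff[OF T_lim[of L] T_exp] by simp
    show "((\<lambda>z. T (z + (- L) * z powr (2/3)) / T z + exp (- 9 * z powr (1/3)) / T z) \<longlongrightarrow> 1) at_top"
      using tendsto_add[OF T_lim[of "- L"] T_exp] by simp
  qed
  moreover have "filterlim (\<lambda>x. x / \<mu>) at_top at_top"
    using mean(2) by real_asymp
  ultimately have "((\<lambda>x. P (x / \<mu>) / T (x / \<mu>)) \<longlongrightarrow> 1) at_top"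
    by (rule filterlim_compose)
  moreover have "tail_prob M (random_sum N X) x = P (x / \<mu>)" for x
    using mean(2) by (simp add: tail_prob_def P_def random_sum_def S_def)
  ultimately show ?thesis
    by (intro asymp_equivI') (simp flip: T_def)
qed

end
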